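(* Let $k$ be a field of characteristic different from $2$ and let $q \in k\setminus\{0\}$ with $q \neq 1$. Let $F = ax^2 + bxy + cy^2 + f$ be a quadratic form (so $a,b,c,f \in k$ with at least one of $a,b,c$ nonzero) which is irreducible in the quantum plane $\mathcal{O}_q(k^2)$. Then $F$ is prime in $\mathcal{O}_q(k^2)$ if and only if $b = 0$ and $q = -1$.
   Context: The quantum plane is $\mathcal{O}_q(k^2) = k[x][y;\sigma]$, where $\sigma$ is the $k$-algebra automorphism of $k[x]$ with $\sigma(x) = qx$; that is, the $k$-algebra generated by $x,y$ subject to $yx = qxy$. It is a domain with $k$-basis $\{x^iy^j\}$. In a domain $A$: an element $a$ is irreducible if it is not a unit and whenever $a = bc$ with $b,c \in A$, either $b$ or $c$ is a unit. We say $a$ divides $c$, written $a \mid c$, if there exists $b \in A$ with $c = ab$ or $c = ba$. An element $a$ is prime if $a \mid bc$ implies $a \mid b$ or $a \mid c$ for all $b,c \in A$. *)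

theory Defs
  imports "HOL-Algebra.Ring" "HOL-Computational_Algebra.Polynomial"
begin

section \<open>Skew polynomial rings\<close>

text \<open>
  For an endomorphism \<open>\<sigma>\<close> of a commutative ring \<open>S\<close>, the elements of \<open>S[y;\<sigma>]\<close> are the finite
  sums \<open>\<Sum> p\<^sub>i y\<^sup>i\<close> with coefficients written on the left, so the additive group is that of the
  type of ordinary polynomials over \<open>S\<close>. The product is determined by
  \<open>(p y\<^sup>i) (r y\<^sup>j) = p \<sigma>\<^sup>i(r) y\<^sup>(\<^sup>i\<^sup>+\<^sup>j\<^sup>)\<close>, i.e. by the rule \<open>y r = \<sigma>(r) y\<close>; it must not be confused with
  the commutative product \<open>(*)\<close> of the polynomial type.
\<close>

definition skew_mult :: "('s::comm_ring_1 \<Rightarrow> 's) \<Rightarrow> 's poly \<Rightarrow> 's poly \<Rightarrow> 's poly" where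
  "skew_mult \<sigma> P R =
     (\<Sum>i\<le>degree P. \<Sum>j\<le>degree R. monom (coeff P i * (\<sigma> ^^ i) (coeff R j)) (i + j))"

definition skew_poly_ring :: "('s::comm_ring_1 \<Rightarrow> 's) \<Rightarrow> 's poly ring" where
  "skew_poly_ring \<sigma> =
     \<lparr>carrier = UNIV, monoid.mult = skew_mult \<sigma>, one = 1, zero = 0, add = (+)\<rparr>"

lemma skew_poly_ring_simps [simp]:
  "carrier (skew_poly_ring \<sigma>) = UNIV"
  "P \<otimes>\<^bsub>skew_poly_ring \<sigma>\<^esub> R = skew_mult \<sigma> P R"
  "\<one>\<^bsub>skew_poly_ring \<sigma>\<^esub> = 1"
  "\<zero>\<^bsub>skew_poly_ring \<sigma>\<^esub> = 0"
  "P \<oplus>\<^bsub>skew_poly_ring \<sigma>\<^esub> R = P + R"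
  by (simp_all add: skew_poly_ring_def)

section \<open>The quantum plane\<close>

text \<open>
  The inner polynomial variable is \<open>x\<close> and the outer one is \<open>y\<close>.
\<close>

definition quantum_plane :: "'k::field \<Rightarrow> 'k poly poly ring" where
  "quantum_plane q = skew_poly_ring (\<lambda>p. pcompose p [:0, q:])"

definition qp_x :: "'k::field poly poly" where
  "qp_x = [:[:0, 1:]:]"

definition qp_y :: "'k::field poly poly" where
  "qp_y = [:0, 1:]"

definition qp_const :: "'k::field \<Rightarrow> 'k poly poly" where
  "qp_const c = [:[:c:]:]"

definition quadratic_form :: "'k::field \<Rightarrow> 'k \<Rightarrow> 'k \<Rightarrow> 'k \<Rightarrow> 'k \<Rightarrow> 'k poly poly" where
  "quadratic_form q a b c f =
     (let A = quantum_plane q in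
        qp_const a \<otimes>\<^bsub>A\<^esub> (qp_x \<otimes>\<^bsub>A\<^esub> qp_x)
        \<oplus>\<^bsub>A\<^esub> qp_const b \<otimes>\<^bsub>A\<^esub> (qp_x \<otimes>\<^bsub>A\<^esub> qp_y)
        \<oplus>\<^bsub>A\<^esub> qp_const c \<otimes>\<^bsub>A\<^esub> (qp_y \<otimes>\<^bsub>A\<^esub> qp_y)
        \<oplus>\<^bsub>A\<^esub> qp_const f)"

section \<open>Irreducible and prime elements of a noncommutative domain\<close>

text \<open>
  The notions of the same kind in HOL-Algebra and in the type-class hierarchy are tailored to
  commutative structures. Here an element divides another if it is a left or a right factor.
\<close>

definition nc_irreducible :: "('a, 'm) ring_scheme \<Rightarrow> 'a \<Rightarrow> bool" where
  "nc_irreducible A a \<longleftrightarrow>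
     a \<in> carrier A \<and> a \<notin> Units A \<and>
     (\<forall>b\<in>carrier A. \<forall>c\<in>carrier A. a = b \<otimes>\<^bsub>A\<^esub> c \<longrightarrow> b \<in> Units A \<or> c \<in> Units A)"

definition nc_divides :: "('a, 'm) ring_scheme \<Rightarrow> 'a \<Rightarrow> 'a \<Rightarrow> bool" where
  "nc_divides A a c \<longleftrightarrow> (\<exists>b\<in>carrier A. c = a \<otimes>\<^bsub>A\<^esub> b \<or> c = b \<otimes>\<^bsub>A\<^esub> a)"

definition nc_prime :: "('a, 'm) ring_scheme \<Rightarrow> 'a \<Rightarrow> bool" where
  "nc_prime A a \<longleftrightarrow>
     a \<in> carrier A \<and>
     (\<forall>b\<in>carrier A. \<forall>c\<in>carrier A.
        nc_divides A a (b \<otimes>\<^bsub>A\<^esub> c) \<longrightarrow> nc_divides A a b \<or> nc_divides A a c)"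

section \<open>Basic facts about the construction\<close>

locale ring_endo =
  fixes \<sigma> :: "'s::comm_ring_1 \<Rightarrow> 's"
  assumes endo_add: "\<sigma> (p + r) = \<sigma> p + \<sigma> r"
    and endo_mult: "\<sigma> (p * r) = \<sigma> p * \<sigma> r"
    and endo_1: "\<sigma> 1 = 1"
begin

lemma endo_0: "\<sigma> 0 = 0"
  using endo_add[of 0 0] by simp

lemma pow_add: "(\<sigma> ^^ i) (p + r) = (\<sigma> ^^ i) p + (\<sigma> ^^ i) r"
  by (induction i) (simp_all add: endo_add)

lemma pow_mult: "(\<sigma> ^^ i) (p * r) = (\<sigma> ^^ i) p * (\<sigma> ^^ i) r"
  by (induction i) (simp_all add: endo_mult)

lemma pow_0 [simp]: "(\<sigma> ^^ i) 0 = 0"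
  by (induction i) (simp_all add: endo_0)

lemma pow_1 [simp]: "(\<sigma> ^^ i) 1 = 1"
  by (induction i) (simp_all add: endo_1)

lemma skew_mult_bound:
  assumes "degree P \<le> m" "degree R \<le> n"
  shows "skew_mult \<sigma> P R =
    (\<Sum>i\<le>m. \<Sum>j\<le>n. monom (coeff P i * (\<sigma> ^^ i) (coeff R j)) (i + j))"
proof -
  have "skew_mult \<sigma> P R =
      (\<Sum>i\<le>degree P. \<Sum>j\<le>n. monom (coeff P i * (\<sigma> ^^ i) (coeff R j)) (i + j))"
    unfolding skew_mult_def using assms(2)
    by (intro sum.cong sum.mono_neutral_left) (auto simp: coeff_eq_0)
  also have "\<dots> = (\<Sum>i\<le>m. \<Sum>j\<le>n. monom (coeff P i * (\<sigma> ^^ i) (coeff R j)) (i + j))"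
    using assms(1) by (intro sum.mono_neutral_left) (auto simp: coeff_eq_0)
  finally show ?thesis .
qed

lemma skew_mult_add_left: "skew_mult \<sigma> (P + P') R = skew_mult \<sigma> P R + skew_mult \<sigma> P' R"
proof -
  define m where "m = max (degree P) (degree P')"
  have "degree (P + P') \<le> m" "degree P \<le> m" "degree P' \<le> m"
    by (auto simp: m_def degree_add_le)
  then show ?thesis
    by (simp add: skew_mult_bound[of _ m R "degree R"] distrib_right add_monom[symmetric]
        sum.distrib)
qed

lemma skew_mult_add_right: "skew_mult \<sigma> P (R + R') = skew_mult \<sigma> P R + skew_mult \<sigma> P R'"
proof -
  define n where "n = max (degree R) (degree R')"
  have "degree (R + R') \<le> n" "degree R \<le> n" "degree R' \<le> n"
    by (auto simp: n_def degree_add_le)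
  then show ?thesis
    by (simp add: skew_mult_bound[of P "degree P" _ n] distrib_left pow_add add_monom[symmetric]
        sum.distrib)
qed

lemma skew_mult_0 [simp]: "skew_mult \<sigma> 0 R = 0" "skew_mult \<sigma> P 0 = 0"
  by (simp_all add: skew_mult_def)

lemma skew_mult_monom:
  "skew_mult \<sigma> (monom p i) (monom r j) = monom (p * (\<sigma> ^^ i) r) (i + j)"
proof -
  have "monom (coeff (monom p i) i' * (\<sigma> ^^ i') (coeff (monom r j) j')) (i' + j') =
      (if j' = j then if i' = i then monom (p * (\<sigma> ^^ i) r) (i + j) else 0 else 0)" for i' j'
    by auto
  then show ?thesis
    by (subst skew_mult_bound[of _ i _ j]) (simp_all only: degree_monom_le, simp)
qed

lemma poly_monom_induct [case_names monom add]:
  assumes "\<And>p i. Q (monom p i)" "\<And>P R. Q P \<Longrightarrow> Q R \<Longrightarrow> Q (P + R)"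
  shows "Q (P :: 's poly)"
proof -
  have "Q (\<Sum>i\<le>n. monom (coeff P i) i)" for n
    by (induction n) (auto intro: assms)
  from this[of "degree P"] show ?thesis
    by (simp add: poly_as_sum_of_monoms)
qed

lemma skew_mult_assoc:
  "skew_mult \<sigma> (skew_mult \<sigma> P R) S = skew_mult \<sigma> P (skew_mult \<sigma> R S)"
proof (induction P rule: poly_monom_induct)
  case (monom p i)
  show ?case
  proof (induction R rule: poly_monom_induct)
    case (monom r j)
    show ?case
    proof (induction S rule: poly_monom_induct)
      case (monom s k)
      show ?case
        by (simp add: skew_mult_monom pow_mult funpow_add mult.assoc add.assoc)
    qed (simp add: skew_mult_add_right)
  qed (simp add: skew_mult_add_right skew_mult_add_left)
qed (simp add: skew_mult_add_left)

lemma skew_mult_1_left: "skew_mult \<sigma> 1 P = P"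
proof (induction P rule: poly_monom_induct)
  case (monom p i)
  show ?case using skew_mult_monom[of 1 0 p i] by simp
qed (simp add: skew_mult_add_right)

lemma skew_mult_1_right: "skew_mult \<sigma> P 1 = P"
proof (induction P rule: poly_monom_induct)
  case (monom p i)
  show ?case using skew_mult_monom[of p i 1 0] by simp
qed (simp add: skew_mult_add_left)

lemma ring_skew_poly_ring: "ring (skew_poly_ring \<sigma>)"
proof (intro ringI abelian_groupI monoidI)
  fix P
  show "\<exists>R\<in>carrier (skew_poly_ring \<sigma>). R \<oplus>\<^bsub>skew_poly_ring \<sigma>\<^esub> P = \<zero>\<^bsub>skew_poly_ring \<sigma>\<^esub>"
    by (auto intro: exI[of _ "- P"])
qed (simp_all add: skew_mult_assoc skew_mult_add_left skew_mult_add_right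
      skew_mult_1_left skew_mult_1_right algebra_simps)

end

interpretation qp: ring_endo "\<lambda>p. pcompose p [:0, q:]" for q :: "'k::field"
  by unfold_locales (simp_all add: pcompose_add pcompose_mult pcompose_1)

lemma ring_quantum_plane: "ring (quantum_plane q)"
  unfolding quantum_plane_def by (rule qp.ring_skew_poly_ring)

lemma qp_relation:
  fixes q :: "'k::field"
  shows
  "qp_y \<otimes>\<^bsub>quantum_plane q\<^esub> qp_x =
     qp_const q \<otimes>\<^bsub>quantum_plane q\<^esub> (qp_x \<otimes>\<^bsub>quantum_plane q\<^esub> qp_y)"
proof -
  have *: "(qp_x :: 'k poly poly) = monom [:0, 1:] 0" "(qp_y :: 'k poly poly) = monom 1 (Suc 0)"
    "qp_const q = monom [:q:] 0"
    by (simp_all add: qp_x_def qp_y_def qp_const_def monom_0 monom_altdef)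
  show ?thesis
    unfolding quantum_plane_def skew_poly_ring_simps * qp.skew_mult_monom
    by (simp add: pcompose_pCons)
qed

end

theory Submission
  imports Defs "HOL-Computational_Algebra.Polynomial_Factorial"
begin

text \<open>
  Moving \<open>x\<close> or \<open>y\<close> across \<open>F\<close> rescales its monomials: \<open>F x = x G\<close> with
  \<open>G = a x\<^sup>2 + q b x y + q\<^sup>2 c y\<^sup>2 + f\<close>, and \<open>y F = G' y\<close> with \<open>G' = q\<^sup>2 a x\<^sup>2 + q b x y + c y\<^sup>2 + f\<close>.
  If \<open>F\<close> is prime, it cannot divide the variable, so it divides the rescaled form; by degree the
  quotient is a constant, and comparing coefficients leaves only \<open>b = 0\<close>, \<open>q = -1\<close> or reducible
  forms.

  Conversely, for \<open>b = 0\<close> and \<open>q = -1\<close> the form \<open>F\<close> is central. If \<open>c = 0\<close>, Gauss' lemma applies to the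
  prime \<open>a x\<^sup>2 + f\<close> of \<open>k[x]\<close>. If \<open>c \<noteq> 0\<close>, everything reduces modulo \<open>F\<close> to the form \<open>p + r y\<close>, as in a
  quaternion algebra, and a zero divisor gives a solution of
  \<open>c p(x) p(-x) = - (a x\<^sup>2 + f) r(x) r(-x)\<close>. Its leading and trailing coefficients give
  \<open>a = c \<alpha>\<^sup>2\<close> and \<open>f = - c \<gamma>\<^sup>2\<close>, whence \<open>F = c (\<alpha> x + y + \<gamma>) (\<alpha> x + y - \<gamma>)\<close> is reducible.
\<close>

section \<open>Coefficients, degrees and units in the skew product\<close>

context ring_endo
begin

lemma coeff_skew_mult:
  "coeff (skew_mult \<sigma> P R) n = (\<Sum>i\<le>n. coeff P i * (\<sigma> ^^ i) (coeff R (n - i)))"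
proof (induction P rule: poly_monom_induct)
  case (monom p i)
  show ?case
  proof (induction R rule: poly_monom_induct)
    case (monom r j)
    have "(\<Sum>m\<le>n. coeff (Polynomial.monom p i) m * (\<sigma> ^^ m) (coeff (Polynomial.monom r j) (n - m)))
      = (\<Sum>m\<le>n. if m = i then p * (\<sigma> ^^ i) (if n - i = j then r else 0) else 0)"
      by (intro sum.cong) auto
    then show ?case
      by (auto simp: skew_mult_monom)
  qed (simp_all add: skew_mult_add_right pow_add algebra_simps sum.distrib)
qed (simp_all add: skew_mult_add_left algebra_simps sum.distrib)

text \<open>Since \<open>y R = \<sigma>(R) y\<close>, one has
  \<open>(p + P y) R = p R + P \<sigma>(R) y\<close>. As a rewrite rule this multiplies out products
  of explicit polynomials.\<close>

lemma skew_mult_pCons: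
  "skew_mult \<sigma> (pCons p P) R = smult p R + pCons 0 (skew_mult \<sigma> P (map_poly \<sigma> R))"
proof (rule poly_eqI)
  fix n
  show "coeff (skew_mult \<sigma> (pCons p P) R) n =
      coeff (smult p R + pCons 0 (skew_mult \<sigma> P (map_poly \<sigma> R))) n"
    by (cases n) (simp_all add: coeff_skew_mult coeff_map_poly endo_0 sum.atMost_Suc_shift
        funpow_Suc_right del: funpow.simps sum.atMost_Suc)
qed

end

abbreviation qmult :: "'k::field \<Rightarrow> 'k poly poly \<Rightarrow> 'k poly poly \<Rightarrow> 'k poly poly" where
  "qmult q \<equiv> skew_mult (\<lambda>p. pcompose p [:0, q:])"

lemmas qmult_simps = qp.skew_mult_pCons map_poly_pCons pcompose_pCons pcompose_1

lemma quantum_plane_simps [simp]: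
  "carrier (quantum_plane q) = UNIV"
  "P \<otimes>\<^bsub>quantum_plane q\<^esub> R = qmult q P R"
  "\<one>\<^bsub>quantum_plane q\<^esub> = 1"
  "P \<oplus>\<^bsub>quantum_plane q\<^esub> R = P + R"
  by (simp_all add: quantum_plane_def)

lemma quadratic_form_eq:
  "quadratic_form q a b c f = [:[:f, 0, a:], [:0, b:], [:c:]:]"
  by (simp add: quadratic_form_def Let_def qp_const_def qp_x_def qp_y_def qmult_simps)

lemma funpow_pcompose_scale:
  fixes p :: "'k::field poly"
  shows "((\<lambda>p. pcompose p [:0, q:]) ^^ i) p = pcompose p [:0, q ^ i:]"
  by (induction i) (simp_all add: pcompose_assoc[symmetric] pcompose_pCons pcompose_idR mult.commute)

lemma pcompose_scale_eq_0_iff: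
  fixes p :: "'k::field poly"
  assumes "q \<noteq> 0"
  shows "pcompose p [:0, q:] = 0 \<longleftrightarrow> p = 0"
  using assms by (intro pcompose_eq_0_iff) simp

lemma coeff_qmult_degree_sum:
  "coeff (qmult q P R) (degree P + degree R) =
     lead_coeff P * pcompose (lead_coeff R) [:0, q ^ degree P:]"
proof -
  have "coeff (qmult q P R) (degree P + degree R) =
      (\<Sum>i\<le>degree P + degree R. if i = degree P
        then lead_coeff P * pcompose (lead_coeff R) [:0, q ^ degree P:] else 0)"
    unfolding qp.coeff_skew_mult
  proof (intro sum.cong refl)
    fix i
    show "coeff P i * ((\<lambda>p. pcompose p [:0, q:]) ^^ i) (coeff R (degree P + degree R - i)) =
        (if i = degree P then lead_coeff P * pcompose (lead_coeff R) [:0, q ^ degree P:] else 0)"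
      by (cases i "degree P" rule: linorder_cases)
        (simp_all add: coeff_eq_0 funpow_pcompose_scale)
  qed
  then show ?thesis by simp
qed

text \<open>For \<open>q \<noteq> 0\<close> the twist is injective on \<open>k[x]\<close>, so the
  product of the leading coefficients, one of them twisted, cannot vanish.\<close>

lemma degree_qmult:
  assumes "q \<noteq> 0" "P \<noteq> 0" "R \<noteq> 0"
  shows "degree (qmult q P R) = degree P + degree R"
proof (rule antisym)
  show "degree (qmult q P R) \<le> degree P + degree R"
  proof (rule degree_le, intro allI impI)
    fix n assume n: "degree P + degree R < n"
    have "coeff P i * ((\<lambda>p. pcompose p [:0, q:]) ^^ i) (coeff R (n - i)) = 0" for i
      using n by (cases "degree P < i") (simp_all add: coeff_eq_0)
    then show "coeff (qmult q P R) n = 0"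
      unfolding qp.coeff_skew_mult by (intro sum.neutral) blast
  qed
  show "degree P + degree R \<le> degree (qmult q P R)"
    using assms by (intro le_degree) (simp add: coeff_qmult_degree_sum pcompose_scale_eq_0_iff)
qed

text \<open>Additivity of the \<open>y\<close>-degree puts a unit and its inverse in
  \<open>k[x]\<close>, whose units are constants.\<close>

lemma Units_quantum_plane:
  assumes "q \<noteq> 0" "u \<in> Units (quantum_plane q)"
  shows "\<exists>e. u = [:[:e:]:]"
proof -
  obtain v where v: "qmult q u v = 1"
    using assms(2) by (auto simp: Units_def)
  have "u \<noteq> 0" "v \<noteq> 0" using v by auto
  with v have "degree u + degree v = 0"
    using degree_qmult[OF assms(1)] by (metis degree_1)
  then obtain p r where pr: "u = [:p:]" "v = [:r:]"
    by (meson add_is_0 degree_eq_zeroE)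
  with v have "p * r = 1" by (simp add: qmult_simps one_pCons)
  then have "is_unit p" by (metis dvd_triv_left)
  then show ?thesis using pr by (auto simp: is_unit_poly_iff)
qed

lemma nc_irreducible_quantum_plane_const_factor:
  assumes "q \<noteq> 0" "nc_irreducible (quantum_plane q) F" "F = qmult q u v"
  shows "(\<exists>e. u = [:[:e:]:]) \<or> (\<exists>e. v = [:[:e:]:])"
proof -
  have "u \<in> Units (quantum_plane q) \<or> v \<in> Units (quantum_plane q)"
    using assms(2,3) by (simp add: nc_irreducible_def)
  then show ?thesis using Units_quantum_plane[OF assms(1)] by blast
qed

section \<open>Primality forces \<open>b = 0\<close> and \<open>q = -1\<close>\<close>

lemma nc_prime_quadratic_form_imp:
  fixes q :: "'k::field"
  assumes q: "q \<noteq> 0" "q \<noteq> 1" and nz: "a \<noteq> 0 \<or> b \<noteq> 0 \<or> c \<noteq> 0"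
    and irr: "nc_irreducible (quantum_plane q) (quadratic_form q a b c f)"
    and prime: "nc_prime (quantum_plane q) (quadratic_form q a b c f)"
  shows "b = 0 \<and> q = -1"
proof -
  define F where "F = quadratic_form q a b c f"
  have F: "F = [:[:f, 0, a:], [:0, b:], [:c:]:]"
    by (simp add: F_def quadratic_form_eq)
  have "F \<noteq> 0" using nz by (auto simp: F)
  note irrF = nc_irreducible_quantum_plane_const_factor[OF q(1) irr[folded F_def]]
  have primeF: "nc_divides (quantum_plane q) F u \<or> nc_divides (quantum_plane q) F v"
    if "qmult q F w = qmult q u v \<or> qmult q w F = qmult q u v" for u v w
    using prime[folded F_def] that unfolding nc_prime_def nc_divides_def by simp metis
  \<comment> \<open>The excluded forms are \<open>e x^2\<close> and \<open>e y^2\<close>, which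
    factor as \<open>(e x) x\<close> and \<open>(e y) y\<close>.\<close>
  have no_square: False if "F = smult [:e:] [:[:0, 0, 1:]:] \<or> F = smult [:e:] [:0, 0, 1:]" for e
  proof -
    have "F = qmult q [:[:0, e:]:] [:[:0, 1:]:] \<or> F = qmult q [:0, [:e:]:] [:0, 1:]"
      using that by (auto simp: qmult_simps one_pCons)
    then show False using irrF \<open>F \<noteq> 0\<close> by (fastforce simp: one_pCons)
  qed
  have sq: "q = -1" if "q ^ 2 = 1"
    using that q by (simp add: power2_eq_1_iff)
  \<comment> \<open>Equal \<open>y\<close>-degrees put the cofactor in \<open>k[x]\<close>; equal
    \<open>x\<close>-degrees of the leading coefficients, which the twist preserves, then make it
    constant.\<close>
  have const_quot: "\<exists>e. G = smult [:e:] F"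
    if dvd: "nc_divides (quantum_plane q) F G" and "G \<noteq> 0"
      and deg: "degree G = degree F" "degree (lead_coeff G) = degree (lead_coeff F)" for G
  proof -
    obtain w where w: "G = qmult q F w \<or> G = qmult q w F"
      using dvd by (auto simp: nc_divides_def)
    with \<open>G \<noteq> 0\<close> have "w \<noteq> 0" by auto
    with w deg(1) \<open>F \<noteq> 0\<close> have "degree w = 0" by (auto simp: degree_qmult q)
    then obtain s where s: "w = [:s:]" by (rule degree_eq_zeroE)
    with \<open>w \<noteq> 0\<close> have "s \<noteq> 0" by simp
    have "coeff (qmult q F [:s:]) (degree F) = lead_coeff F * pcompose s [:0, q ^ degree F:]"
      using coeff_qmult_degree_sum[of q F "[:s:]"] by simp
    moreover have "coeff (qmult q [:s:] F) (degree F) = s * lead_coeff F"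
      by (simp add: qp.skew_mult_pCons)
    ultimately have "lead_coeff G = lead_coeff F * pcompose s [:0, q ^ degree F:] \<or>
        lead_coeff G = s * lead_coeff F"
      using w s deg(1) by auto
    moreover have "lead_coeff F \<noteq> 0" "pcompose s [:0, q ^ degree F:] \<noteq> 0"
      using \<open>F \<noteq> 0\<close> \<open>s \<noteq> 0\<close> q by (simp_all add: pcompose_scale_eq_0_iff)
    ultimately have "degree s = 0"
      using deg(2) \<open>s \<noteq> 0\<close> q by (auto simp: degree_mult_eq degree_pcompose)
    then obtain e where "s = [:e:]" by (rule degree_eq_zeroE)
    then have "G = smult [:e:] F"
      using w s by (auto simp: F qmult_simps mult.commute)
    then show ?thesis ..
  qed
  show ?thesis
  \<comment> \<open>If \<open>b = c = 0\<close>, then \<open>F\<close> lies in \<open>k[x]\<close>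
    and commutes with \<open>x\<close>, so \<open>y\<close> is used to rescale it; otherwise
    \<open>x\<close> is used.\<close>
  proof (cases "b = 0 \<and> c = 0")
    case True
    define G where "G = [:[:f, 0, q\<^sup>2 * a:]:]"
    have "a \<noteq> 0" using True nz by simp
    have "qmult q [:0, 1:] F = qmult q G [:0, 1:]"
      by (simp add: F G_def qmult_simps True one_pCons power2_eq_square)
    then consider "nc_divides (quantum_plane q) F [:0, 1:]" | "nc_divides (quantum_plane q) F G"
      using primeF by metis
    then show ?thesis
    proof cases
      case 1
      then obtain w where "[:0, 1:] = qmult q F w \<or> [:0, 1:] = qmult q w F"
        by (auto simp: nc_divides_def)
      \<comment> \<open>Comparing coefficients of \<open>y\<close> turns a quadratic polynomial in
        \<open>x\<close> into a unit.\<close>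
      then have "coeff (qmult q F w) 1 = 1 \<or> coeff (qmult q w F) 1 = 1"
        by (metis One_nat_def coeff_pCons_0 coeff_pCons_Suc)
      then have "[:f, 0, a:] * coeff w 1 = 1 \<or> coeff w 1 * [:f, 0, q\<^sup>2 * a:] = 1"
        by (simp add: qp.coeff_skew_mult F True pcompose_pCons power2_eq_square mult_ac)
      then have "is_unit [:f, 0, a:] \<or> is_unit [:f, 0, q\<^sup>2 * a:]"
        by (metis dvd_triv_left dvd_triv_right)
      then show ?thesis using \<open>a \<noteq> 0\<close> q by (simp add: is_unit_iff_degree)
    next
      case 2
      then obtain e where e: "G = smult [:e:] F"
        using const_quot[of G] \<open>a \<noteq> 0\<close> q by (auto simp: G_def F True)
      \<comment> \<open>The constant terms now give \<open>e = 1\<close>, while the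
        \<open>x^2\<close> terms give \<open>e = q^2\<close>.\<close>
      have "f \<noteq> 0" using no_square[of a] by (auto simp: F True)
      with e \<open>a \<noteq> 0\<close> have "q\<^sup>2 = 1" by (auto simp: G_def F True)
      then show ?thesis using True sq by simp
    qed
  next
    case False
    define G where "G = [:[:f, 0, a:], [:0, q * b:], [:q\<^sup>2 * c:]:]"
    have "qmult q F [:[:0, 1:]:] = qmult q [:[:0, 1:]:] G"
      by (simp add: F G_def qmult_simps one_pCons power2_eq_square)
    then consider "nc_divides (quantum_plane q) F [:[:0, 1:]:]" | "nc_divides (quantum_plane q) F G"
      using primeF by metis
    then show ?thesis
    proof cases
      case 1
      then obtain w where w: "[:[:0, 1:]:] = qmult q F w \<or> [:[:0, 1:]:] = qmult q w F"
        by (auto simp: nc_divides_def)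
      then have "w \<noteq> 0" by auto
      have "degree (qmult q F w) = 0 \<or> degree (qmult q w F) = 0"
        using w by (metis degree_pCons_0)
      then have "degree F = 0" using \<open>w \<noteq> 0\<close> \<open>F \<noteq> 0\<close> by (auto simp: degree_qmult q)
      then show ?thesis using False by (auto simp: F split: if_splits)
    next
      case 2
      then obtain e where G: "G = smult [:e:] F"
        using const_quot[of G] False q by (auto simp: G_def F)
      show ?thesis
      proof (cases "c = 0")
        case True
        \<comment> \<open>Here \<open>b \<noteq> 0\<close>, so the \<open>xy\<close> terms give
          \<open>e = q\<close>; as \<open>q \<noteq> 1\<close>, only \<open>F = b x y\<close>
          remains, which is reducible.\<close>
        with G have "e = q" "a = 0" "f = 0" using False q by (auto simp: F G_def)
        then have "F = qmult q [:[:0, b:]:] [:0, 1:]"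
          by (simp add: F True qmult_simps)
        then have "(\<exists>e. [:[:0, b:]:] = [:[:e:]:]) \<or> (\<exists>e::'k. [:0, 1:] = [:[:e:]:])"
          by (rule irrF)
        then show ?thesis using False True by simp
      next
        case False
        \<comment> \<open>The \<open>y^2\<close> terms fix \<open>e\<close>, and
          \<open>q b = q^2 b\<close> kills \<open>b\<close>. If \<open>q^2 \<noteq> 1\<close>, then
          also \<open>a = f = 0\<close> and \<open>F = c y^2\<close>.\<close>
        with G have "e = q\<^sup>2" "b = 0" "a = q\<^sup>2 * a" "f = q\<^sup>2 * f" using q by (auto simp: F G_def power2_eq_square)
        then show ?thesis using no_square[of c] sq by (auto simp: F one_pCons)
      qed
    qed
  qed
qed

section \<open>The norm equation\<close>

text \<open>Descent on the degree of \<open>p\<close>: for \<open>f \<noteq> 0\<close>, evaluation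
  at 0 either yields \<open>\<gamma> = p(0) / r(0)\<close> or shows that \<open>x\<close> divides
  both \<open>p\<close> and \<open>r\<close> and can be cancelled.\<close>

lemma norm_equation_trailing:
  fixes p r :: "'k::field poly"
  assumes "smult c (p * pcompose p [:0, -1:]) = - ([:f, 0, a:] * (r * pcompose r [:0, -1:]))"
    and "p \<noteq> 0" "c \<noteq> 0"
  shows "\<exists>\<gamma>. f = - c * \<gamma>\<^sup>2"
  using assms
proof (induction "degree p" arbitrary: p r rule: less_induct)
  case less
  show ?case
  proof (cases "f = 0")
    case True
    then show ?thesis by (intro exI[of _ 0]) simp
  next
    case False
    have eq: "c * (poly p 0)\<^sup>2 = - f * (poly r 0)\<^sup>2"
      using arg_cong[OF less.prems(1), of "\<lambda>s. poly s 0"]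
      by (simp add: poly_pcompose power2_eq_square)
    show ?thesis
    proof (cases "poly r 0 = 0")
      case True
      with eq less.prems(3) have "poly p 0 = 0" by simp
      with True obtain p' r' where pr: "p = [:0, 1:] * p'" "r = [:0, 1:] * r'"
        by (auto simp: poly_eq_0_iff_dvd elim!: dvdE)
      \<comment> \<open>\<open>X\<close> is \<open>x\<close> times its twist, the factor that
        extracting \<open>x\<close> from \<open>s\<close> contributes to
        \<open>s(x) s(-x)\<close>.\<close>
      define X :: "'k poly" where "X = [:0, 1:] * [:0, -1:]"
      have "X \<noteq> 0" by (simp add: X_def)
      have split: "([:0, 1:] * s) * pcompose ([:0, 1:] * s) [:0, -1:] = X * (s * pcompose s [:0, -1:])"
        for s :: "'k poly"
        unfolding X_def pcompose_mult by (simp only: pcompose_pCons) (simp add: mult_ac)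
      have "X * smult c (p' * pcompose p' [:0, -1:]) =
          X * (- ([:f, 0, a:] * (r' * pcompose r' [:0, -1:])))"
        using less.prems(1) unfolding pr split by (simp only: mult_smult_right mult_minus_right mult.left_commute[of X])
      then have "smult c (p' * pcompose p' [:0, -1:]) =
          - ([:f, 0, a:] * (r' * pcompose r' [:0, -1:]))"
        using \<open>X \<noteq> 0\<close> mult_left_cancel by blast
      moreover have "p' \<noteq> 0" using pr less.prems(2) by auto
      moreover have "degree p' < degree p" using pr \<open>p' \<noteq> 0\<close> by (simp add: degree_mult_eq)
      ultimately show ?thesis using less.hyps less.prems(3) by blast
    next
      case False
      then have "f = - c * (poly p 0 / poly r 0)\<^sup>2"
        using eq by (simp add: field_simps)
      then show ?thesis ..
    qed
  qed
qed

text \<open>For \<open>a \<noteq> 0\<close>, \<open>\<alpha>\<close> is the ratio of the leading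
  coefficients of \<open>p\<close> and \<open>r\<close>. Their degrees differ by one, so the signs
  caused by the substitution of \<open>-x\<close> cancel the minus sign of the equation.\<close>

lemma norm_equation_leading:
  fixes p r :: "'k::field poly"
  assumes eq: "smult c (p * pcompose p [:0, -1:]) = - ([:f, 0, a:] * (r * pcompose r [:0, -1:]))"
    and "p \<noteq> 0" "c \<noteq> 0"
  shows "\<exists>\<alpha>. a = c * \<alpha>\<^sup>2"
proof (cases "a = 0")
  case True
  then show ?thesis by (intro exI[of _ 0]) simp
next
  case False
  have nz: "pcompose s [:0, -1:] \<noteq> 0" if "s \<noteq> 0" for s :: "'k poly"
    using that pcompose_scale_eq_0_iff[of "-1" s] by simp
  have "r \<noteq> 0"
  proof
    assume "r = 0"
    with eq have "smult c (p * pcompose p [:0, -1:]) = 0" by simp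
    then show False using assms(2,3) nz by simp
  qed
  have "degree (smult c (p * pcompose p [:0, -1:])) = 2 * degree p"
    using assms(2,3) nz by (simp add: degree_mult_eq degree_pcompose)
  moreover have "degree (- ([:f, 0, a:] * (r * pcompose r [:0, -1:]))) = 2 * degree r + 2"
    unfolding degree_minus using \<open>r \<noteq> 0\<close> nz[of r] False
    by (subst degree_mult_eq) (simp_all add: degree_mult_eq degree_pcompose del: mult_pCons_left)
  ultimately have deg: "degree p = Suc (degree r)" unfolding eq by simp
  have lc: "lead_coeff (pcompose s [:0, -1:]) = lead_coeff s * (-1) ^ degree s" for s :: "'k poly"
    by (subst lead_coeff_comp) simp_all
  have "c * (lead_coeff p * (lead_coeff p * (-1) ^ degree p)) =
      - (a * (lead_coeff r * (lead_coeff r * (-1) ^ degree r)))"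
    using arg_cong[OF eq, of lead_coeff] False
    by (simp only: lead_coeff_smult lead_coeff_minus lead_coeff_mult lc) simp
  then have "c * (lead_coeff p)\<^sup>2 = a * (lead_coeff r)\<^sup>2"
    by (simp add: deg power2_eq_square uminus_power_if split: if_splits)
  then have "a = c * (lead_coeff p / lead_coeff r)\<^sup>2"
    using \<open>r \<noteq> 0\<close> by (simp add: field_simps)
  then show ?thesis ..
qed

text \<open>Since \<open>yx = -xy\<close>, the mixed terms of \<open>(\<alpha> x + y)^2\<close>
  cancel, so the form is \<open>c\<close> times a difference of the squares of
  \<open>\<alpha> x + y\<close> and the scalar \<open>\<gamma>\<close>.\<close>

lemma irreducible_imp_no_square_coeffs:
  assumes "nc_irreducible (quantum_plane (-1)) [:[:f, 0, a:], 0, [:c:]:]" "c \<noteq> 0"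
  shows "\<not> (a = c * \<alpha>\<^sup>2 \<and> f = - c * \<gamma>\<^sup>2)"
proof
  assume "a = c * \<alpha>\<^sup>2 \<and> f = - c * \<gamma>\<^sup>2"
  then have "[:[:f, 0, a:], 0, [:c:]:] =
      qmult (-1) [:[:c * \<gamma>, c * \<alpha>:], [:c:]:] [:[:- \<gamma>, \<alpha>:], 1:]"
    by (simp add: qmult_simps power2_eq_square mult_ac)
  from nc_irreducible_quantum_plane_const_factor[OF _ assms(1) this] assms(2)
  show False by simp
qed

section \<open>Central forms at \<open>q = -1\<close>\<close>

text \<open>
  Here \<open>*\<close> is the commutative product of the polynomial type, so one-sided division by a central
  form becomes ordinary divisibility.
\<close>

lemma qmult_even_central:
  fixes g h :: "'k::field poly"
  assumes "pcompose g [:0, -1:] = g" "pcompose h [:0, -1:] = h"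
  shows "qmult (-1) [:g, 0, h:] u = [:g, 0, h:] * u" "qmult (-1) u [:g, 0, h:] = [:g, 0, h:] * u"
proof -
  have inv: "pcompose (pcompose p [:0, -1:]) [:0, -1:] = p" for p :: "'k poly"
    by (simp add: pcompose_assoc[symmetric] pcompose_pCons pcompose_idR)
  \<comment> \<open>Passing \<open>y\<close> twice undoes the twist, so \<open>y^2\<close> is
    central.\<close>
  have "map_poly (\<lambda>p. pcompose p [:0, -1:]) (map_poly (\<lambda>p. pcompose p [:0, -1:]) u) = u"
    by (rule poly_eqI) (simp add: coeff_map_poly inv)
  then show "qmult (-1) [:g, 0, h:] u = [:g, 0, h:] * u"
    by (simp add: qp.skew_mult_pCons)
  show "qmult (-1) u [:g, 0, h:] = [:g, 0, h:] * u"
  proof (induction u)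
    case (pCons p u)
    then show ?case
      by (simp add: qp.skew_mult_pCons map_poly_pCons assms mult.commute[of _ p] add_ac)
  qed simp
qed

lemma even_pcompose:
  "pcompose [:f, 0, a:] [:0, -1:] = [:f, 0, a:]" "pcompose [:c:] [:0, -1:] = [:c:]"
  for a c f :: "'k::field"
  by (simp_all add: pcompose_pCons)

lemma nc_divides_even_central_iff:
  fixes a c f :: "'k::field"
  defines "F \<equiv> [:[:f, 0, a:], 0, [:c:]:]"
  shows "nc_divides (quantum_plane (-1)) F u \<longleftrightarrow> F dvd u"
  by (auto simp: nc_divides_def dvd_def F_def qmult_even_central[OF even_pcompose])

section \<open>Primality for \<open>c \<noteq> 0\<close>\<close>

lemma quadratic_reduction:
  fixes g :: "'k::field poly"
  assumes "c \<noteq> 0"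
  shows "\<exists>w p r. u = [:g, 0, [:c:]:] * w + [:p, r:]"
proof (induction u)
  case 0
  show ?case by (intro exI[of _ 0]) simp
next
  case (pCons h u)
  then obtain w p r where u: "u = [:g, 0, [:c:]:] * w + [:p, r:]" by blast
  define s where "s = smult (inverse c) r"
  have s: "smult c s = r" using assms by (simp add: s_def)
  \<comment> \<open>Multiplying the remainder by \<open>y\<close> creates \<open>r y^2\<close>;
    since \<open>c s = r\<close>, this equals the form times \<open>s\<close> minus
    \<open>g s\<close>.\<close>
  have "pCons h u = [:g, 0, [:c:]:] * pCons s w + [:h - g * s, p:]"
    using s by (simp add: u algebra_simps)
  then show ?case by blast
qed

lemma nc_prime_nondegenerate:
  fixes a c f :: "'k::field"
  defines "F \<equiv> [:[:f, 0, a:], 0, [:c:]:]"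
  assumes irr: "nc_irreducible (quantum_plane (-1)) F" and "c \<noteq> 0"
  shows "nc_prime (quantum_plane (-1)) F"
proof -
  let ?\<sigma> = "\<lambda>p::'k poly. pcompose p [:0, -1:]"
  have central: "qmult (-1) F u = F * u" "qmult (-1) u F = F * u" for u
    by (simp_all add: F_def qmult_even_central[OF even_pcompose])
  have mult_F: "qmult (-1) (F * w) u = F * qmult (-1) w u"
      "qmult (-1) u (F * w) = F * qmult (-1) u w" for u w
    by (simp only: central(1)[symmetric] qp.skew_mult_assoc)
      (simp only: central(2)[symmetric] qp.skew_mult_assoc)
  have inv: "?\<sigma> (?\<sigma> p) = p" for p
    by (simp add: pcompose_assoc[symmetric] pcompose_pCons pcompose_idR)
  define g where "g = [:f, 0, a:]"
  have F: "F = [:g, 0, [:c:]:]" by (simp add: F_def g_def)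
  have no_square: "\<not> (a = c * \<alpha>\<^sup>2 \<and> f = - c * \<gamma>\<^sup>2)" for \<alpha> \<gamma>
    using irreducible_imp_no_square_coeffs irr \<open>c \<noteq> 0\<close> unfolding F_def by blast
  have "g \<noteq> 0" using no_square[of 0 0] by (auto simp: g_def)
  have reduced: "[:p, r:] = 0 \<or> [:p', r':] = 0" if "F dvd qmult (-1) [:p, r:] [:p', r':]" for p r p' r'
  proof (rule ccontr)
    assume nz: "\<not> ([:p, r:] = 0 \<or> [:p', r':] = 0)"
    have "qmult (-1) [:p, r:] [:p', r':] =
        [:p * p', p * r' + r * ?\<sigma> p', r * ?\<sigma> r':]"
      by (simp add: qmult_simps)
    with that obtain w where w: "[:p * p', p * r' + r * ?\<sigma> p', r * ?\<sigma> r':] = F * w"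
      by (metis dvdE)
    \<comment> \<open>The product has \<open>y\<close>-degree at most 2, the \<open>y\<close>-degree
      of \<open>F\<close>, so the quotient lies in \<open>k[x]\<close>.\<close>
    have "degree w = 0"
    proof (cases "w = 0")
      case False
      then have "degree (F * w) = 2 + degree w"
        using \<open>c \<noteq> 0\<close> by (subst degree_mult_eq) (auto simp: F_def)
      moreover have "degree (F * w) \<le> 2" by (simp flip: w)
      ultimately show ?thesis by simp
    qed simp
    then obtain s where s: "w = [:s:]" by (rule degree_eq_zeroE)
    have e0: "p * p' = g * s" and e1: "p * r' + r * ?\<sigma> p' = 0" and e2: "r * ?\<sigma> r' = smult c s"
      using w by (simp_all add: F s)
    have e3: "smult c (p * p') = g * (r * ?\<sigma> r')"
      by (simp only: e0 e2 mult_smult_right)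
    \<comment> \<open>The twisted \<open>y\<close>-coefficient eliminates \<open>r'\<close> from
      \<open>e3\<close> multiplied by the twist of \<open>p\<close>; what remains is
      \<open>p'\<close> times the norm equation.\<close>
    have "?\<sigma> (p * r' + r * ?\<sigma> p') = 0" by (simp add: e1)
    then have e4: "?\<sigma> p * ?\<sigma> r' = - (?\<sigma> r * p')"
      by (simp add: pcompose_add pcompose_mult inv eq_neg_iff_add_eq_0)
    have "p' * smult c (p * ?\<sigma> p) = ?\<sigma> p * smult c (p * p')"
      by (simp add: mult_ac)
    also have "\<dots> = g * r * (?\<sigma> p * ?\<sigma> r')"
      unfolding e3 by (simp only: mult_ac)
    also have "\<dots> = p' * (- (g * (r * ?\<sigma> r)))"
      unfolding e4 by (simp only: mult_minus_right mult_minus_left mult_ac)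
    finally have e5: "p' * smult c (p * ?\<sigma> p) = p' * (- (g * (r * ?\<sigma> r)))" .
    have \<sigma>0: "?\<sigma> p = 0 \<longleftrightarrow> p = 0" for p
      using pcompose_scale_eq_0_iff[of "-1"] by simp
    have "p' \<noteq> 0"
    proof
      assume "p' = 0"
      with nz e1 have "p = 0" by auto
      with nz \<open>p' = 0\<close> e3 \<open>g \<noteq> 0\<close> show False by (simp add: \<sigma>0)
    qed
    with e5 have e6: "smult c (p * ?\<sigma> p) = - (g * (r * ?\<sigma> r))"
      using mult_left_cancel by blast
    have "p \<noteq> 0"
    proof
      assume "p = 0"
      with e6 \<open>g \<noteq> 0\<close> nz show False by (simp add: \<sigma>0)
    qed
    with e6 show False
      unfolding g_def using norm_equation_leading norm_equation_trailing no_square \<open>c \<noteq> 0\<close> by blast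
  qed
  have "F dvd u \<or> F dvd v" if "F dvd qmult (-1) u v" for u v
  proof -
    obtain w p r where u: "u = F * w + [:p, r:]"
      using quadratic_reduction[OF \<open>c \<noteq> 0\<close>] unfolding F by blast
    obtain w' p' r' where v: "v = F * w' + [:p', r':]"
      using quadratic_reduction[OF \<open>c \<noteq> 0\<close>] unfolding F by blast
    have "qmult (-1) u v = qmult (-1) (F * w) v +
        (qmult (-1) [:p, r:] (F * w') + qmult (-1) [:p, r:] [:p', r':])"
      by (simp only: u v qp.skew_mult_add_left qp.skew_mult_add_right add_ac)
    also have "\<dots> = F * qmult (-1) w v +
        (F * qmult (-1) [:p, r:] w' + qmult (-1) [:p, r:] [:p', r':])"
      by (simp only: mult_F)
    finally have "F dvd qmult (-1) [:p, r:] [:p', r':]"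
      using that by (simp add: dvd_add_right_iff)
    then have "[:p, r:] = 0 \<or> [:p', r':] = 0" by (rule reduced)
    then show ?thesis unfolding u v by (metis add.right_neutral dvd_triv_left)
  qed
  then show ?thesis
    unfolding nc_prime_def by (simp add: nc_divides_even_central_iff F_def)
qed

section \<open>Primality for \<open>c = 0\<close>\<close>

lemma nc_prime_degenerate:
  fixes a f :: "'k::field"
  defines "F \<equiv> [:[:f, 0, a:]:]"
  assumes irr: "nc_irreducible (quantum_plane (-1)) F" and "a \<noteq> 0"
  shows "nc_prime (quantum_plane (-1)) F"
proof -
  define g where "g = [:f, 0, a:]"
  have F: "F = [:g:]" by (simp add: F_def g_def)
  have "prime_elem g"
  proof (rule field_poly_irreducible_imp_prime, rule irreducibleI)
    show "g \<noteq> 0" "\<not> is_unit g"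
      using \<open>a \<noteq> 0\<close> by (simp_all add: g_def is_unit_iff_degree)
    fix s t assume st: "g = s * t"
    then have "F = qmult (-1) [:s:] [:t:]" by (simp add: F qmult_simps)
    from nc_irreducible_quantum_plane_const_factor[OF _ irr this]
    have "degree s = 0 \<or> degree t = 0" by auto
    moreover have "s \<noteq> 0" "t \<noteq> 0" using st \<open>g \<noteq> 0\<close> by auto
    ultimately show "is_unit s \<or> is_unit t" by (simp add: is_unit_iff_degree)
  qed
  \<comment> \<open>As \<open>g\<close> is even, changing the sign of \<open>x\<close> preserves
    divisibility by \<open>g\<close>.\<close>
  have pcompose_dvd: "g dvd pcompose p [:0, (-1) ^ i:]" if "g dvd p" for p i
  proof -
    have "pcompose g [:0, (-1) ^ i:] = g"
      by (simp add: g_def pcompose_pCons flip: power_add mult_2)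
    then show ?thesis using that by (metis dvd_def pcompose_mult)
  qed
  have pcompose_dvd_iff: "g dvd pcompose p [:0, (-1) ^ i:] \<longleftrightarrow> g dvd p" for p i
  proof
    assume "g dvd pcompose p [:0, (-1) ^ i:]"
    then have "g dvd pcompose (pcompose p [:0, (-1) ^ i:]) [:0, (-1) ^ i:]" by (rule pcompose_dvd)
    then show "g dvd p"
      by (simp add: pcompose_assoc[symmetric] pcompose_pCons pcompose_idR flip: power_add mult_2)
  qed (rule pcompose_dvd)
  have "F dvd u \<or> F dvd v" if "F dvd qmult (-1) u v" for u v
  proof (rule ccontr)
    assume "\<not> (F dvd u \<or> F dvd v)"
    then have ex: "\<exists>n. \<not> g dvd coeff u n" "\<exists>n. \<not> g dvd coeff v n"
      by (auto simp: F const_poly_dvd_iff)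
    \<comment> \<open>With \<open>i\<close> and \<open>j\<close> the first indices where
      divisibility by \<open>g\<close> fails, every term of the coefficient of
      \<open>y^(i+j)\<close> except the one at \<open>i\<close> is divisible by
      \<open>g\<close>.\<close>
    define i where "i = (LEAST n. \<not> g dvd coeff u n)"
    define j where "j = (LEAST n. \<not> g dvd coeff v n)"
    have i: "\<not> g dvd coeff u i" "\<And>n. n < i \<Longrightarrow> g dvd coeff u n"
      unfolding i_def using LeastI_ex[OF ex(1)] not_less_Least by blast+
    have j: "\<not> g dvd coeff v j" "\<And>n. n < j \<Longrightarrow> g dvd coeff v n"
      unfolding j_def using LeastI_ex[OF ex(2)] not_less_Least by blast+
    let ?t = "\<lambda>n. coeff u n * pcompose (coeff v (i + j - n)) [:0, (-1) ^ n:]"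
    have "g dvd coeff (qmult (-1) u v) (i + j)"
      using that by (simp add: F const_poly_dvd_iff)
    also have "coeff (qmult (-1) u v) (i + j) = (\<Sum>n\<le>i + j. ?t n)"
      by (simp add: qp.coeff_skew_mult funpow_pcompose_scale)
    also have "\<dots> = ?t i + (\<Sum>n\<in>{..i + j} - {i}. ?t n)"
      by (rule sum.remove) auto
    finally have "g dvd ?t i + (\<Sum>n\<in>{..i + j} - {i}. ?t n)" .
    moreover have "g dvd (\<Sum>n\<in>{..i + j} - {i}. ?t n)"
    proof (rule dvd_sum)
      fix n assume "n \<in> {..i + j} - {i}"
      then have "n < i \<or> i + j - n < j" by auto
      then show "g dvd ?t n" using i(2) j(2) pcompose_dvd by (auto intro: dvd_mult dvd_mult2)
    qed
    ultimately have "g dvd ?t i" by (simp add: dvd_add_left_iff)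
    then show False
      using i(1) j(1) \<open>prime_elem g\<close> by (simp add: prime_elem_dvd_mult_iff pcompose_dvd_iff)
  qed
  \<comment> \<open>At \<open>c = 0\<close> the vanishing top coefficients drop out, and the central
    form is the constant polynomial \<open>[:g:]\<close> in \<open>y\<close>.\<close>
  moreover have "nc_divides (quantum_plane (-1)) F u \<longleftrightarrow> F dvd u" for u
    using nc_divides_even_central_iff[of f a 0 u] by (simp add: F_def)
  ultimately show ?thesis
    unfolding nc_prime_def by simp
qed

theorem theorem9:
  fixes q a b c f :: "'k::field"
  assumes "CHAR('k) \<noteq> 2"
    and "q \<noteq> 0" and "q \<noteq> 1"
    and "a \<noteq> 0 \<or> b \<noteq> 0 \<or> c \<noteq> 0"
    and "nc_irreducible (quantum_plane q) (quadratic_form q a b c f)"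
  shows "nc_prime (quantum_plane q) (quadratic_form q a b c f) \<longleftrightarrow> b = 0 \<and> q = -1"
proof
  assume "nc_prime (quantum_plane q) (quadratic_form q a b c f)"
  with assms show "b = 0 \<and> q = -1" by (intro nc_prime_quadratic_form_imp)
next
  assume bq: "b = 0 \<and> q = -1"
  then have F: "quadratic_form q a b c f = [:[:f, 0, a:], 0, [:c:]:]"
    by (simp add: quadratic_form_eq)
  have "q = -1" using bq by simp
  note irr = assms(5)[unfolded F, unfolded this]
  show "nc_prime (quantum_plane q) (quadratic_form q a b c f)"
    unfolding F unfolding \<open>q = -1\<close>
  proof (cases "c = 0")
    case True
    then show "nc_prime (quantum_plane (-1)) [:[:f, 0, a:], 0, [:c:]:]"
      using assms(4) bq irr nc_prime_degenerate[of f a] by simp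
  next
    case False
    with irr show "nc_prime (quantum_plane (-1)) [:[:f, 0, a:], 0, [:c:]:]"
      by (rule nc_prime_nondegenerate)
  qed
qed

end
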